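(* Let $\mathbb{F}_q$ be a finite field of characteristic $p$. Suppose that $f\in\mathbb{F}_q[x]$ has degree $D>1$ and is neither of the form $ax^k$ nor of the form $ax^{p^h}+b$ (with $a,b\in\mathbb{F}_q$ and integers $k\ge 1$, $h\ge 0$). Let $d>1$ be the degree of the $p$-reduction of $f$. Then the following hold: (i) $\Delta_n(f)\approx d^n$; (ii) $D_n(f)\gg n$; (iii) there exists $C_f>0$ such that, for any $n\ge 0$, either $r_n(f)\ge C_f\cdot d^{n/2}$ or $D_n(f)\ge C_f\cdot d^{n/2}$.
   Context: For a polynomial $f$, put $f^{(0)}(x)=x$ and $f^{(n)}(x)=f(f^{(n-1)}(x))$ for $n\ge1$. $\Delta_n(f)$ is the degree of the squarefree part of $f^{(n)}(x)$ (the product of its distinct irreducible factors over $\mathbb{F}_q$); $r_n(f)$ is the number of distinct irreducible factors of $f^{(n)}(x)$ over $\mathbb{F}_q$; $D_n(f)$ is the largest degree of an irreducible factor of $f^{(n)}(x)$ over $\mathbb{F}_q$. The $p$-reduction of a non-constant $f\in\mathbb{F}_q[x]$ is the unique $F\in\mathbb{F}_q[x]$ such that $f(x)=F(x)^{p^h}$ for some $h\ge 0$ and the formal derivative $F'(x)$ is not the zero polynomial. For positive-valued functions $A,B$ of a positive integer $n$, $A\gg B$ means that there is a constant $c>0$ with $A(n)\ge c\,B(n)$ for all $n$, and $A\approx B$ means $A\gg B$ and $B\gg A$. *)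

theory Defs
  imports Complex_Main "HOL-Computational_Algebra.Computational_Algebra"
begin

definition poly_iter :: "'a::comm_ring_1 poly \<Rightarrow> nat \<Rightarrow> 'a poly" where
  "poly_iter f n = (pcompose f ^^ n) [:0, 1:]"

text \<open>Irreducible factors are identified up to units, each being represented by its monic
  associate.\<close>

definition irr_factors :: "'a::field poly \<Rightarrow> 'a poly set" where
  "irr_factors g = {P. irreducible P \<and> lead_coeff P = 1 \<and> P dvd g}"

definition squarefree_part :: "'a::field poly \<Rightarrow> 'a poly" where
  "squarefree_part g = \<Prod>(irr_factors g)"

definition Delta_iter :: "'a::field poly \<Rightarrow> nat \<Rightarrow> nat" where
  "Delta_iter f n = degree (squarefree_part (poly_iter f n))"

definition r_iter :: "'a::field poly \<Rightarrow> nat \<Rightarrow> nat" where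
  "r_iter f n = card (irr_factors (poly_iter f n))"

definition D_iter :: "'a::field poly \<Rightarrow> nat \<Rightarrow> nat" where
  "D_iter f n = Max (degree ` irr_factors (poly_iter f n))"

definition is_p_reduction :: "'a::finite_field poly \<Rightarrow> 'a poly \<Rightarrow> bool" where
  "is_p_reduction f F \<longleftrightarrow> (\<exists>h. f = F ^ (CHAR('a) ^ h)) \<and> pderiv F \<noteq> 0"

definition p_reduction :: "'a::finite_field poly \<Rightarrow> 'a poly" where
  "p_reduction f = (THE F. is_p_reduction f F)"

text \<open>The relations between functions of a positive integer; the value at 0 is ignored.\<close>

definition dominates :: "(nat \<Rightarrow> real) \<Rightarrow> (nat \<Rightarrow> real) \<Rightarrow> bool" (infix "\<ggreater>" 50) where
  "A \<ggreater> B \<longleftrightarrow> (\<exists>c>0. \<forall>n\<ge>1. A n \<ge> c * B n)"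

definition same_order :: "(nat \<Rightarrow> real) \<Rightarrow> (nat \<Rightarrow> real) \<Rightarrow> bool" (infix "\<approx>" 50) where
  "A \<approx> B \<longleftrightarrow> A \<ggreater> B \<and> B \<ggreater> A"

lemma finite_irr_factors:
  fixes g :: "'a::finite_field poly"
  assumes "g \<noteq> 0"
  shows "finite (irr_factors g)"
proof (rule finite_subset)
  have len: "length (coeffs P) \<le> Suc (degree P)" for P :: "'a poly"
    by (cases "P = 0") (simp_all add: length_coeffs_degree)
  show "irr_factors g \<subseteq> Poly ` {xs. set xs \<subseteq> UNIV \<and> length xs \<le> Suc (degree g)}"
  proof
    fix P assume "P \<in> irr_factors g"
    hence "degree P \<le> degree g" using assms by (auto simp: irr_factors_def dvd_imp_degree_le)
    with len[of P] have "length (coeffs P) \<le> Suc (degree g)" by linarith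
    moreover have "P = Poly (coeffs P)" by simp
    ultimately show "P \<in> Poly ` {xs. set xs \<subseteq> UNIV \<and> length xs \<le> Suc (degree g)}"
      by (intro image_eqI[of _ _ "coeffs P"]) simp_all
  qed
  show "finite (Poly ` {xs :: 'a list. set xs \<subseteq> UNIV \<and> length xs \<le> Suc (degree g)})"
    by (intro finite_imageI finite_lists_length_le) simp
qed

lemma frobenius_inj:
  fixes x y :: "'b::idom"
  assumes "prime CHAR('b)" "x ^ (CHAR('b) ^ n) = y ^ (CHAR('b) ^ n)"
  shows "x = y"
proof -
  have "(y + (x - y)) ^ (CHAR('b) ^ n) = y ^ (CHAR('b) ^ n) + (x - y) ^ (CHAR('b) ^ n)"
    by (rule freshmans_dream') (use assms in auto)
  with assms have "(x - y) ^ (CHAR('b) ^ n) = 0" by simp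
  thus ?thesis by simp
qed

lemma frobenius_surj:
  fixes c :: "'a::finite_field"
  shows "\<exists>b. b ^ CHAR('a) = c"
proof -
  have "inj (\<lambda>x::'a. x ^ CHAR('a))"
    using frobenius_inj[where n = 1 and 'b = 'a] by (auto intro!: injI)
  hence "surj (\<lambda>x::'a. x ^ CHAR('a))" by (simp add: finite_UNIV_inj_surj)
  thus ?thesis by (metis surjD)
qed

lemma pderiv_0_imp_power:
  fixes f :: "'a::finite_field poly"
  assumes "pderiv f = 0"
  shows "\<exists>g. f = g ^ CHAR('a)"
proof -
  define p where "p = CHAR('a)"
  have p: "p > 0" by (simp add: p_def)
  obtain s where s: "\<And>c::'a. s c ^ p = c" unfolding p_def using frobenius_surj by metis
  define g where "g = (\<Sum>j\<le>degree f. monom (s (coeff f (p * j))) j)"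
  have "g ^ p = (\<Sum>j\<le>degree f. monom (s (coeff f (p * j))) j ^ p)"
    unfolding g_def by (rule freshmans_dream_sum) (simp_all add: p_def)
  also have "\<dots> = (\<Sum>j\<le>degree f. monom (coeff f (p * j)) (p * j))"
    by (simp add: monom_power s mult.commute)
  also have "\<dots> = f"
  proof (rule poly_eqI)
    fix i
    show "coeff (\<Sum>j\<le>degree f. monom (coeff f (p * j)) (p * j)) i = coeff f i"
    proof (cases "p dvd i")
      case True
      then obtain k where k: "i = p * k" by blast
      have "coeff (\<Sum>j\<le>degree f. monom (coeff f (p * j)) (p * j)) i
          = (\<Sum>j\<le>degree f. if j = k then coeff f i else 0)"
        using p by (simp add: coeff_sum k)
      also have "\<dots> = (if k \<le> degree f then coeff f i else 0)" by simp
      also have "\<dots> = coeff f i"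
      proof (cases "k \<le> degree f")
        case False
        moreover have "k \<le> i" using p by (simp add: k)
        ultimately show ?thesis by (simp add: coeff_eq_0)
      qed simp
      finally show ?thesis .
    next
      case False
      then obtain m where m: "i = Suc m" by (cases i) auto
      have "of_nat (Suc m) * coeff f (Suc m) = 0"
        using assms by (metis coeff_pderiv coeff_0)
      moreover have "(of_nat (Suc m) :: 'a) \<noteq> 0"
        using False unfolding of_nat_eq_0_iff_char_dvd p_def m by simp
      ultimately have "coeff f i = 0" using m by auto
      with False show ?thesis by (auto simp: coeff_sum intro!: sum.neutral)
    qed
  qed
  finally show ?thesis unfolding p_def by metis
qed

lemma p_reduction_ex:
  fixes f :: "'a::finite_field poly"
  assumes "degree f > 0"
  shows "\<exists>F. is_p_reduction f F"
  using assms
proof (induction "degree f" arbitrary: f rule: less_induct)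
  case (less f)
  show ?case
  proof (cases "pderiv f = 0")
    case False
    thus ?thesis unfolding is_p_reduction_def by (metis power_0 power_one_right)
  next
    case True
    then obtain g where g: "f = g ^ CHAR('a)" using pderiv_0_imp_power by blast
    hence deg: "degree f = CHAR('a) * degree g"
      by (cases "g = 0") (simp_all add: degree_power_eq power_0_left)
    have "CHAR('a) > 1" by (rule prime_gt_1_nat) simp
    with deg less.prems have "degree g < degree f" "degree g > 0" by auto
    from less.hyps[OF this] obtain F h where F: "g = F ^ (CHAR('a) ^ h)" "pderiv F \<noteq> 0"
      by (auto simp: is_p_reduction_def)
    have "f = F ^ (CHAR('a) ^ Suc h)" by (simp add: g F flip: power_mult) (simp add: mult.commute)
    with F(2) show ?thesis unfolding is_p_reduction_def by blast
  qed
qed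

lemma p_reduction_unique_aux:
  fixes F G :: "'a::finite_field poly"
  assumes "F ^ (CHAR('a) ^ h) = G ^ (CHAR('a) ^ k)" "h \<le> k" "pderiv F \<noteq> 0"
  shows "F = G"
proof -
  obtain m where m: "k = h + m" using assms(2) le_Suc_ex by blast
  have "F ^ (CHAR('a) ^ h) = (G ^ (CHAR('a) ^ m)) ^ (CHAR('a) ^ h)"
    using assms(1) by (simp add: m power_add mult.commute flip: power_mult)
  hence F: "F = G ^ (CHAR('a) ^ m)"
    using frobenius_inj[where 'b = "'a poly" and n = h] by simp
  have "m = 0"
  proof (rule ccontr)
    assume "m \<noteq> 0"
    hence "CHAR('a) dvd CHAR('a) ^ m" by (simp add: dvd_power)
    hence "(of_nat (CHAR('a) ^ m) :: 'a) = 0" by (simp only: of_nat_eq_0_iff_char_dvd)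
    hence "pderiv F = 0" unfolding F pderiv_power by simp
    with assms(3) show False by contradiction
  qed
  with F show ?thesis by simp
qed

lemma p_reduction_ex1:
  fixes f :: "'a::finite_field poly"
  assumes "degree f > 0"
  shows "\<exists>!F. is_p_reduction f F"
proof (rule ex_ex1I[OF p_reduction_ex[OF assms]])
  fix F G assume "is_p_reduction f F" "is_p_reduction f G"
  then obtain h k where "F ^ (CHAR('a) ^ h) = G ^ (CHAR('a) ^ k)"
    "pderiv F \<noteq> 0" "pderiv G \<noteq> 0" unfolding is_p_reduction_def by metis
  thus "F = G"
    using p_reduction_unique_aux[of F h G k] p_reduction_unique_aux[of G k F h]
    by (cases "h \<le> k") auto
qed

lemma is_p_reduction_p_reduction:
  "degree f > 0 \<Longrightarrow> is_p_reduction f (p_reduction f)"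
  unfolding p_reduction_def by (rule theI') (rule p_reduction_ex1)

lemma degree_p_reduction_gt_1:
  fixes f :: "'a::finite_field poly"
  assumes "degree f > 0"
    and "\<nexists>a b h. f = monom a (CHAR('a) ^ h) + [:b:]"
  shows "degree (p_reduction f) > 1"
proof (rule ccontr)
  assume "\<not> degree (p_reduction f) > 1"
  then obtain u v where F: "p_reduction f = [:u, v:]"
    using degree1_coeffs[of "p_reduction f"] degree_eq_zeroE[of "p_reduction f"]
    by (metis less_one linorder_neqE_nat pCons_0_0)
  obtain h where h: "f = [:u, v:] ^ (CHAR('a) ^ h)"
    using is_p_reduction_p_reduction[OF assms(1)] by (auto simp: is_p_reduction_def F)
  have "[:u, v:] = monom v 1 + [:u:]" by (simp add: monom_Suc monom_0)
  hence "f = (monom v 1 + [:u:]) ^ (CHAR('a) ^ h)" using h by simp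
  also have "\<dots> = monom v 1 ^ (CHAR('a) ^ h) + [:u:] ^ (CHAR('a) ^ h)"
    by (rule freshmans_dream') simp_all
  also have "\<dots> = monom (v ^ (CHAR('a) ^ h)) (CHAR('a) ^ h) + [:u ^ (CHAR('a) ^ h):]"
    by (simp add: monom_power poly_const_pow)
  finally show False using assms(2) by blast
qed

end

theory Submission
  imports Defs
begin

text \<open>
  Write \<open>f = F\<^sup>q\<close> with \<open>q\<close> a power of the characteristic, \<open>F\<close> the \<open>p\<close>-reduction and
  \<open>d = deg F\<close>.  Over an algebraic closure, \<open>\<Delta>\<^sub>n(f)\<close> is the number of points in the backward
  orbit \<open>f\<^sup>-\<^sup>n(0)\<close>.  Taking \<open>q\<close>-th roots is a bijection, so a preimage under \<open>f\<close> is a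
  preimage under \<open>F\<close> of a set of the same size.  A point has at most \<open>d\<close> preimages under
  \<open>F\<close>, which gives \<open>\<Delta>\<^sub>n\<^sub>+\<^sub>1 \<le> d \<Delta>\<^sub>n\<close>.  In the other direction, the preimage of a finite set
  loses points only where \<open>F\<close> is ramified, and a point with ramification index \<open>e\<close> is a zero
  of \<open>F'\<close> of order at least \<open>e - 1\<close>.  Since \<open>F'\<close> is nonzero of degree at most \<open>d - 1\<close>, the
  total loss over all points is at most \<open>d - 1\<close>, so
  \<open>\<Delta>\<^sub>n\<^sub>+\<^sub>1 - 1 \<ge> d (\<Delta>\<^sub>n - 1)\<close>.  This forces growth of order \<open>d\<^sup>n\<close> as soon as some \<open>\<Delta>\<^sub>n\<close>
  exceeds 1, and excluding the monomials makes \<open>\<Delta>\<^sub>2 \<ge> 2\<close>: if \<open>0\<close> has a single preimage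
  \<open>\<alpha>\<close>, then \<open>F = c (x - \<alpha>)\<^sup>d\<close> ramifies only over \<open>0\<close>, and so \<open>\<alpha> \<noteq> 0\<close> has \<open>d\<close> preimages.

  The formal proof says the same without leaving the base field.  Finite sets of points become
  squarefree polynomials \<open>g\<close>, preimages become the squarefree part of \<open>g \<circ> F\<close>, and the
  ramification bound is \<open>degree_pcompose_le_squarefree_part\<close>: a prime power \<open>P\<^sup>k\<^sup>+\<^sup>1\<close> dividing
  \<open>g \<circ> F\<close> gives \<open>P\<^sup>k\<close> dividing \<open>(g' \<circ> F) F'\<close>, and \<open>P\<close> cannot divide the first factor because
  \<open>g\<close> and \<open>g'\<close> are coprime.  The \<open>q\<close>-th roots are handled by
  \<open>squarefree_pcompose_power_char\<close>, which twists the coefficients by the inverse Frobenius, and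
  the second iterate by \<open>squarefree_part_second_iterate\<close>.

  The claims about \<open>D\<^sub>n\<close> and \<open>r\<^sub>n\<close> follow from \<open>\<Delta>\<^sub>n \<le> r\<^sub>n D\<^sub>n\<close>.  One of two factors is
  at least the square root of their product, which is the dichotomy; and \<open>r\<^sub>n\<close> is at most the
  number of polynomials of degree at most \<open>D\<^sub>n\<close>, so \<open>d\<^sup>n\<close> is at most exponential in \<open>D\<^sub>n\<close>.
\<close>

section \<open>Monic irreducible factors\<close>

lemma irr_factorsD:
  assumes "P \<in> irr_factors g"
  shows "prime_elem P" "irreducible P" "lead_coeff P = 1" "P dvd g" "P \<noteq> 0" "degree P > 0"
proof -
  show irr: "irreducible P" and "lead_coeff P = 1" "P dvd g"
    using assms by (auto simp: irr_factors_def)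
  show "prime_elem P" by (rule field_poly_irreducible_imp_prime) (rule irr)
  show "P \<noteq> 0" using irr by auto
  show "degree P > 0"
    using irr by (metis gr0I is_unit_iff_degree irreducible_not_unit not_irreducible_zero)
qed

lemma irreducible_monic_dvd_imp_eq:
  fixes P Q :: "'a::field poly"
  assumes "irreducible P" "irreducible Q" "lead_coeff P = 1" "lead_coeff Q = 1" "P dvd Q"
  shows "P = Q"
proof -
  have "Q dvd P"
    using irreducibleD'[OF assms(2,5)] assms(1) by (auto simp: irreducible_not_unit)
  moreover have "P \<noteq> 0" "Q \<noteq> 0" using assms(3,4) by auto
  ultimately have "degree P = degree Q" using assms(5) by (intro antisym dvd_imp_degree_le)
  moreover obtain c where c: "Q = P * c" using assms(5) by blast
  ultimately have "degree c = 0" using \<open>Q \<noteq> 0\<close> by (auto simp: degree_mult_eq)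
  then obtain a where "c = [:a:]" using degree_eq_zeroE by blast
  with c have Q: "Q = smult a P" by simp
  with assms(3,4) have "a = 1" by (metis lead_coeff_smult mult.right_neutral)
  with Q show ?thesis by simp
qed

lemma irr_factor_exists:
  fixes g :: "'a::field poly"
  assumes "degree g > 0"
  shows "\<exists>P. P \<in> irr_factors g"
  using assms
proof (induction "degree g" arbitrary: g rule: less_induct)
  case (less g)
  have g0: "g \<noteq> 0" using less.prems by auto
  show ?case
  proof (cases "irreducible g")
    case True
    define c where "c = inverse (lead_coeff g)"
    have c: "c \<noteq> 0" using g0 by (simp add: c_def)
    have "smult c g = [:c:] * g" by simp
    also have "irreducible \<dots> \<longleftrightarrow> irreducible g"
      using c by (intro irreducible_mult_unit_left) (simp add: is_unit_pCons_iff)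
    finally have "irreducible (smult c g)" using True by simp
    moreover have "lead_coeff (smult c g) = 1" using g0 by (simp add: c_def)
    moreover have "smult c g dvd g" using c by (simp add: smult_dvd_iff)
    ultimately show ?thesis unfolding irr_factors_def by blast
  next
    case False
    moreover have "\<not> is_unit g" using less.prems g0 by (simp add: is_unit_iff_degree)
    ultimately obtain a b where ab: "g = a * b" "\<not> is_unit a" "\<not> is_unit b"
      using g0 unfolding irreducible_def by blast
    with g0 have "a \<noteq> 0" "b \<noteq> 0" by auto
    with ab have "degree a < degree g" "degree a > 0"
      by (auto simp: is_unit_iff_degree degree_mult_eq)
    from less.hyps[OF this] obtain P where "P \<in> irr_factors a" by blast
    hence "P \<in> irr_factors g" unfolding irr_factors_def by (auto simp: ab)
    thus ?thesis by blast
  qed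
qed

lemma irr_factors_mult:
  fixes a b :: "'a::field poly"
  shows "irr_factors (a * b) = irr_factors a \<union> irr_factors b"
proof (intro equalityI subsetI)
  fix P assume P: "P \<in> irr_factors (a * b)"
  hence "P dvd a \<or> P dvd b"
    using irr_factorsD(1,4)[OF P] by (simp add: prime_elem_dvd_mult_iff)
  with P show "P \<in> irr_factors a \<union> irr_factors b" by (auto simp: irr_factors_def)
qed (auto simp: irr_factors_def)

lemma irr_factors_power:
  fixes a :: "'a::field poly"
  assumes "n > 0"
  shows "irr_factors (a ^ n) = irr_factors a"
  using assms
  by (auto simp: irr_factors_def prime_elem_dvd_power_iff field_poly_irreducible_imp_prime)

lemma irr_factors_irreducible:
  fixes P :: "'a::field poly"
  assumes "irreducible P" "lead_coeff P = 1"
  shows "irr_factors P = {P}"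
  using assms irreducible_monic_dvd_imp_eq by (auto simp: irr_factors_def)

lemma irr_factors_one: "irr_factors (1 :: 'a::field poly) = {}"
  by (auto simp: irr_factors_def irreducible_def)

lemma irr_factors_prod:
  fixes A :: "'a::field poly set"
  assumes "finite A" "\<And>P. P \<in> A \<Longrightarrow> irreducible P \<and> lead_coeff P = 1"
  shows "irr_factors (\<Prod>A) = A"
  using assms
  by (induction A rule: finite_induct)
     (auto simp: irr_factors_one irr_factors_mult irr_factors_irreducible)

lemma irr_factors_squarefree_part:
  fixes g :: "'a::finite_field poly"
  assumes "g \<noteq> 0"
  shows "irr_factors (squarefree_part g) = irr_factors g"
  unfolding squarefree_part_def
  by (rule irr_factors_prod[OF finite_irr_factors[OF assms]]) (auto dest: irr_factorsD)

lemma squarefree_part_nonzero: "squarefree_part (g :: 'a::field poly) \<noteq> 0"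
  unfolding squarefree_part_def
  by (cases "finite (irr_factors g)") (auto dest: irr_factorsD)

lemma degree_squarefree_part:
  "degree (squarefree_part (g :: 'a::field poly)) = (\<Sum>P\<in>irr_factors g. degree P)"
  unfolding squarefree_part_def by (rule degree_prod_sum_eq) (auto dest: irr_factorsD)

lemma squarefree_squarefree_part:
  fixes g :: "'a::finite_field poly"
  assumes "g \<noteq> 0"
  shows "squarefree (squarefree_part g)"
proof (rule squarefreeI, rule ccontr)
  fix x assume x: "x ^ 2 dvd squarefree_part g" "\<not> is_unit x"
  with squarefree_part_nonzero[of g] have "x \<noteq> 0" by auto
  with x have "degree x > 0" by (simp add: is_unit_iff_degree)
  then obtain P where P: "P \<in> irr_factors x" using irr_factor_exists by blast
  let ?I = "irr_factors g"
  have fin: "finite ?I" by (rule finite_irr_factors[OF assms])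
  have "P ^ 2 dvd squarefree_part g"
    using irr_factorsD(4)[OF P] x(1) by (meson dvd_power_same dvd_trans)
  moreover from this have "P dvd squarefree_part g" by (metis dvd_mult_left power2_eq_square)
  hence PI: "P \<in> ?I" using P irr_factors_squarefree_part[OF assms]
    by (auto simp: irr_factors_def)
  hence "squarefree_part g = P * \<Prod>(?I - {P})"
    unfolding squarefree_part_def using fin by (rule prod.remove[rotated])
  ultimately have "P dvd \<Prod>(?I - {P})"
    using irr_factorsD(5)[OF P] by (simp add: power2_eq_square)
  hence "P \<in> irr_factors (\<Prod>(?I - {P}))" using P by (auto simp: irr_factors_def)
  also have "\<dots> = ?I - {P}" using fin by (intro irr_factors_prod) (auto dest: irr_factorsD)
  finally show False by simp
qed

text \<open>In terms of roots: the preimage of a set is the union of the preimages of its points.\<close>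

lemma irr_factors_pcompose:
  fixes a f :: "'a::field poly"
  assumes "a \<noteq> 0"
  shows "irr_factors (pcompose a f) = (\<Union>k\<in>irr_factors a. irr_factors (pcompose k f))"
proof (intro equalityI subsetI)
  fix P assume "P \<in> (\<Union>k\<in>irr_factors a. irr_factors (pcompose k f))"
  then obtain k where "k dvd a" "P \<in> irr_factors (pcompose k f)" by (auto dest: irr_factorsD)
  thus "P \<in> irr_factors (pcompose a f)" by (auto simp: pcompose_mult irr_factors_mult)
next
  fix P assume "P \<in> irr_factors (pcompose a f)"
  thus "P \<in> (\<Union>k\<in>irr_factors a. irr_factors (pcompose k f))"
    using assms
  proof (induction "degree a" arbitrary: a rule: less_induct)
    case (less a)
    show ?case
    proof (cases "degree a = 0")
      case True
      then obtain c where "a = [:c:]" using degree_eq_zeroE by blast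
      with less.prems(2) have "is_unit (pcompose a f)" by (simp add: is_unit_pCons_iff)
      with less.prems(1) show ?thesis
        by (meson dvd_trans irr_factorsD(2,4) irreducible_not_unit)
    next
      case False
      then obtain k where k: "k \<in> irr_factors a" using irr_factor_exists by blast
      then obtain b where b: "a = k * b" by (auto dest: irr_factorsD)
      hence "degree b < degree a" "b \<noteq> 0"
        using less.prems(2) irr_factorsD(5,6)[OF k] by (auto simp: degree_mult_eq)
      thus ?thesis using less.hyps[of b] less.prems(1) k
        by (auto simp: b pcompose_mult irr_factors_mult)
    qed
  qed
qed

text \<open>The monic irreducible factors are peeled off one at a time: a new factor is prime and differs
  from those already removed, so it divides the cofactor.\<close>

lemma squarefree_part_dvd:
  fixes g :: "'a::finite_field poly"
  assumes "g \<noteq> 0"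
  shows "squarefree_part g dvd g"
proof -
  have "\<Prod>A dvd g" if "finite A" "A \<subseteq> irr_factors g" for A
    using that
  proof (induction A rule: finite_induct)
    case (insert P A)
    then obtain c where c: "g = \<Prod>A * c" by auto
    have P: "P \<in> irr_factors g" using insert.prems by simp
    have "irr_factors (\<Prod>A) = A"
      using insert by (intro irr_factors_prod) (auto dest: irr_factorsD)
    hence "P \<in> irr_factors c"
      using P insert.hyps(2) by (auto simp: c irr_factors_mult)
    hence "P dvd c" by (rule irr_factorsD)
    thus ?case using insert.hyps by (simp add: c mult.commute)
  qed simp
  thus ?thesis unfolding squarefree_part_def using finite_irr_factors[OF assms] by blast
qed

section \<open>Separability over a finite field\<close>

lemma degree_pderiv_less:
  fixes F :: "'a::idom poly"
  assumes "pderiv F \<noteq> 0"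
  shows "degree (pderiv F) < degree F"
proof -
  have "degree (pderiv F) \<le> degree F - 1"
    by (rule degree_le) (simp add: coeff_pderiv coeff_eq_0)
  moreover have "degree F \<noteq> 0"
    using assms by (metis degree_eq_zeroE pderiv_singleton)
  ultimately show ?thesis by linarith
qed

text \<open>The usual principal ideal argument: a nonzero element of least degree in the ideal generated by
  \<open>a\<close> and \<open>b\<close> divides both, so it is a constant.\<close>

lemma bezout_field_poly:
  fixes a b :: "'a::field poly"
  assumes "a \<noteq> 0" "irr_factors a \<inter> irr_factors b = {}"
  shows "\<exists>u v. u * a + v * b = 1"
proof -
  define I where "I = {u * a + v * b | u v. True}"
  have "a = 1 * a + 0 * b" "b = 0 * a + 1 * b" by simp_all
  hence ab: "a \<in> I" "b \<in> I" unfolding I_def by blast+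
  define g where "g = arg_min degree (\<lambda>x. x \<in> I \<and> x \<noteq> 0)"
  have g: "g \<in> I" "g \<noteq> 0" and min: "\<And>x. x \<in> I \<Longrightarrow> x \<noteq> 0 \<Longrightarrow> degree g \<le> degree x"
    using arg_min_nat_lemma[of "\<lambda>x. x \<in> I \<and> x \<noteq> 0" a degree] ab(1) assms(1)
    unfolding g_def by auto
  obtain u v where uv: "g = u * a + v * b" using g(1) by (auto simp: I_def)
  have dvd: "g dvd x" if "x \<in> I" for x
  proof (rule ccontr)
    assume "\<not> g dvd x"
    hence nz: "x mod g \<noteq> 0" by (simp add: mod_eq_0_iff_dvd)
    obtain u' v' where x: "x = u' * a + v' * b"
      using \<open>x \<in> I\<close> unfolding I_def by blast
    define w where "w = x div g"
    have "x mod g = x - w * g" by (simp add: w_def minus_div_mult_eq_mod)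
    also have "\<dots> = (u' - w * u) * a + (v' - w * v) * b"
      by (simp add: x uv algebra_simps)
    finally have "x mod g \<in> I" unfolding I_def by blast
    thus False using min[OF _ nz] degree_mod_less'[OF g(2) nz] by fastforce
  qed
  have "degree g = 0"
  proof (rule ccontr)
    assume "degree g \<noteq> 0"
    then obtain P where "P \<in> irr_factors g" using irr_factor_exists by blast
    hence "P \<in> irr_factors a \<inter> irr_factors b"
      using dvd[OF ab(1)] dvd[OF ab(2)] by (auto simp: irr_factors_def)
    thus False using assms(2) by simp
  qed
  then obtain c where c: "g = [:c:]" using degree_eq_zeroE by blast
  have "smult (inverse c) u * a + smult (inverse c) v * b = smult (inverse c) g"
    by (simp add: uv smult_add_right)
  also have "\<dots> = 1" using g(2) by (simp add: c one_pCons)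
  finally show ?thesis by blast
qed

text \<open>Finiteness of the field enters through its being perfect.  A common factor \<open>P\<close> of \<open>g = P k\<close>
  and \<open>g'\<close> divides \<open>k P'\<close> and hence \<open>P'\<close>, which has smaller degree; so \<open>P' = 0\<close>, which makes
  \<open>P\<close> a \<open>p\<close>-th power and contradicts irreducibility.\<close>

lemma squarefree_imp_coprime_pderiv:
  fixes g :: "'a::finite_field poly"
  assumes "squarefree g"
  shows "irr_factors g \<inter> irr_factors (pderiv g) = {}"
proof (rule ccontr)
  assume "irr_factors g \<inter> irr_factors (pderiv g) \<noteq> {}"
  then obtain P where P: "P \<in> irr_factors g" and P': "P dvd pderiv g"
    by (auto dest: irr_factorsD)
  obtain k where k: "g = P * k" using P by (auto dest: irr_factorsD)
  have ndvd: "\<not> P dvd k"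
  proof
    assume "P dvd k"
    hence "P ^ 2 dvd g" by (auto simp: k power2_eq_square)
    with assms have "is_unit P" by (rule squarefreeD)
    thus False using irr_factorsD(2)[OF P] by (simp add: irreducible_not_unit)
  qed
  have "P dvd k * pderiv P"
    using P' by (simp add: k pderiv_mult dvd_add_right_iff)
  with ndvd have "P dvd pderiv P"
    using irr_factorsD(1)[OF P] by (auto dest: prime_elem_dvd_multD)
  hence "pderiv P = 0"
    using degree_pderiv_less[of P] dvd_imp_degree_le[of P "pderiv P"] by fastforce
  then obtain Q where Q: "P = Q ^ CHAR('a)" using pderiv_0_imp_power by blast
  have "CHAR('a) > 1" by (rule prime_gt_1_nat) simp
  then obtain m where m: "CHAR('a) = Suc (Suc m)"
    by (metis One_nat_def less_imp_Suc_add add_Suc plus_1_eq_Suc)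
  have "P = Q * Q ^ Suc m" by (simp add: Q m)
  with irr_factorsD(2)[OF P] have "is_unit Q \<or> is_unit (Q ^ Suc m)" by (rule irreducibleD)
  hence "is_unit Q" by (auto simp: is_unit_power_iff simp del: power_Suc)
  hence "is_unit P" by (simp add: Q is_unit_power_iff)
  thus False using irr_factorsD(2)[OF P] by (simp add: irreducible_not_unit)
qed

section \<open>Preimages under a separable polynomial\<close>

lemma prime_power_split:
  fixes P H :: "'a::field poly"
  assumes "degree P > 0" "H \<noteq> 0"
  shows "\<exists>m K. H = P ^ m * K \<and> \<not> P dvd K"
  using assms(2)
proof (induction "degree H" arbitrary: H rule: less_induct)
  case (less H)
  show ?case
  proof (cases "P dvd H")
    case False
    thus ?thesis by (intro exI[of _ 0] exI[of _ H]) simp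
  next
    case True
    then obtain L where L: "H = P * L" by blast
    with less.prems assms(1) have "degree L < degree H" "L \<noteq> 0" by (auto simp: degree_mult_eq)
    from less.hyps[OF this] obtain m K where "L = P ^ m * K" "\<not> P dvd K" by blast
    thus ?thesis by (intro exI[of _ "Suc m"] exI[of _ K]) (simp add: L)
  qed
qed

text \<open>If \<open>H\<close> is, up to a unit, the product of prime powers \<open>P\<^sup>e\<close>, the hypothesis makes \<open>X\<close>
  divisible by the product of the \<open>P\<^sup>e\<^sup>-\<^sup>1\<close>, which is the quotient of \<open>H\<close> by its squarefree part.
  The induction removes the full power of one \<open>P\<close> from \<open>H\<close> and the corresponding lower power
  from \<open>X\<close>.\<close>

lemma degree_le_squarefree_part_plus:
  fixes H X :: "'a::finite_field poly"
  assumes "H \<noteq> 0" "X \<noteq> 0"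
    and "\<And>P k. P \<in> irr_factors H \<Longrightarrow> P ^ Suc k dvd H \<Longrightarrow> P ^ k dvd X"
  shows "degree H \<le> degree (squarefree_part H) + degree X"
  using assms
proof (induction "degree H" arbitrary: H X rule: less_induct)
  case (less H X)
  show ?case
  proof (cases "degree H = 0")
    case False
    then obtain P where P: "P \<in> irr_factors H" using irr_factor_exists by blast
    obtain m K where K: "H = P ^ m * K" "\<not> P dvd K"
      using prime_power_split[OF irr_factorsD(6)[OF P] less.prems(1)] by blast
    have K0: "K \<noteq> 0" using K(2) by auto
    have "m \<noteq> 0" using irr_factorsD(4)[OF P] K by (cases m) auto
    then obtain l where m: "m = Suc l" by (cases m) auto
    have "P ^ l dvd X" using less.prems(3)[OF P, of l] by (simp add: K(1) m)
    then obtain Y where Y: "X = P ^ l * Y" by blast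
    have Y0: "Y \<noteq> 0" using less.prems(2) Y by auto
    have irr: "irr_factors H = insert P (irr_factors K)"
      using irr_factorsD(2,3)[OF P]
      by (simp add: K(1) m irr_factors_mult irr_factors_power irr_factors_irreducible
          del: power_Suc)
    have PK: "P \<notin> irr_factors K" using K(2) by (auto simp: irr_factors_def)
    have degH: "degree H = m * degree P + degree K"
      using K0 irr_factorsD(5)[OF P] by (simp add: K(1) degree_mult_eq degree_power_eq)
    have degX: "degree X = l * degree P + degree Y"
      using Y0 irr_factorsD(5)[OF P] by (simp add: Y degree_mult_eq degree_power_eq)
    have degrad: "degree (squarefree_part H) = degree P + degree (squarefree_part K)"
      using PK finite_irr_factors[OF K0] by (simp add: degree_squarefree_part irr)
    have "degree K < degree H" using irr_factorsD(6)[OF P] by (simp add: degH m)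
    hence "degree K \<le> degree (squarefree_part K) + degree Y"
    proof (rule less.hyps[OF _ K0 Y0])
      fix Q k assume Q: "Q \<in> irr_factors K" and dvd: "Q ^ Suc k dvd K"
      have "Q ^ k dvd X"
        using Q dvd by (intro less.prems(3)) (auto simp: irr_factors_mult K(1) simp del: power_Suc)
      hence "Q ^ 1 dvd P ^ l \<or> Q ^ k dvd Y"
        unfolding Y by (rule prime_elem_power_dvd_cases) (simp_all add: irr_factorsD[OF Q])
      moreover have "\<not> Q dvd P ^ l"
      proof
        assume "Q dvd P ^ l"
        hence "Q dvd P" using irr_factorsD(1)[OF Q] prime_elem_dvd_power by blast
        hence "Q = P" using irr_factorsD[OF P] irr_factorsD[OF Q] irreducible_monic_dvd_imp_eq
          by blast
        thus False using PK Q by simp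
      qed
      ultimately show "Q ^ k dvd Y" by simp
    qed
    thus ?thesis by (simp add: degH degX degrad m)
  qed simp
qed

lemma power_Suc_dvd_imp_power_dvd_pderiv:
  fixes P H :: "'a::idom poly"
  assumes "P ^ Suc k dvd H"
  shows "P ^ k dvd pderiv H"
proof -
  obtain L where L: "H = P ^ Suc k * L" using assms by blast
  have "pderiv H = P ^ k * (P * pderiv L + L * smult (of_nat (Suc k)) (pderiv P))"
    unfolding L pderiv_mult pderiv_power_Suc by (simp add: algebra_simps smult_add_left)
  thus ?thesis by simp
qed

text \<open>The ramification bound.  Distinct roots of \<open>g \<circ> F\<close> fall short of
  \<open>deg g \<cdot> deg F\<close> by at most the number of zeros of \<open>F'\<close> with multiplicity, however large \<open>g\<close> is.  Composing a
  Bezout identity for \<open>g\<close> and \<open>g'\<close> with \<open>F\<close> shows that \<open>g \<circ> F\<close> and \<open>g' \<circ> F\<close> have no common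
  factor, so repeated factors of \<open>g \<circ> F\<close> must come from \<open>F'\<close>.\<close>

lemma degree_pcompose_le_squarefree_part:
  fixes g F :: "'a::finite_field poly"
  assumes "squarefree g" "pderiv F \<noteq> 0"
  shows "degree g * degree F \<le> degree (squarefree_part (pcompose g F)) + (degree F - 1)"
proof -
  have g0: "g \<noteq> 0" using assms(1) by auto
  have F: "degree F > 0" using degree_pderiv_less[OF assms(2)] by simp
  obtain u v where uv: "u * g + v * pderiv g = 1"
    using bezout_field_poly[OF g0 squarefree_imp_coprime_pderiv[OF assms(1)]] by blast
  hence "pcompose (u * g + v * pderiv g) F = 1" by (simp add: pcompose_1)
  hence uvF: "pcompose u F * pcompose g F + pcompose v F * pcompose (pderiv g) F = 1"
    by (simp add: pcompose_add pcompose_mult)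
  have "degree (pcompose g F) \<le> degree (squarefree_part (pcompose g F)) + degree (pderiv F)"
  proof (rule degree_le_squarefree_part_plus)
    show "pcompose g F \<noteq> 0" using g0 F by (simp add: pcompose_eq_0_iff)
    fix P k assume P: "P \<in> irr_factors (pcompose g F)" and k: "P ^ Suc k dvd pcompose g F"
    have "\<not> P dvd pcompose (pderiv g) F"
    proof
      assume "P dvd pcompose (pderiv g) F"
      hence "P dvd 1" using irr_factorsD(4)[OF P] by (metis uvF dvd_add dvd_mult)
      thus False using irr_factorsD(2)[OF P] by (simp add: irreducible_not_unit)
    qed
    moreover have "P ^ k dvd pcompose (pderiv g) F * pderiv F"
      using power_Suc_dvd_imp_power_dvd_pderiv[OF k] by (simp add: pderiv_pcompose)
    hence "P ^ 1 dvd pcompose (pderiv g) F \<or> P ^ k dvd pderiv F"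
      by (rule prime_elem_power_dvd_cases) (simp_all add: irr_factorsD[OF P])
    ultimately show "P ^ k dvd pderiv F" by simp
  qed (rule assms(2))
  thus ?thesis using degree_pderiv_less[OF assms(2)] by (simp add: degree_pcompose)
qed

section \<open>Absorbing the Frobenius map\<close>

text \<open>Raising to the power \<open>q\<close> is a ring endomorphism, so it passes through the polynomial
  expression \<open>g(F)\<close> onto the coefficients of \<open>g\<close> and onto \<open>F\<close>.\<close>

lemma pcompose_frobenius:
  fixes g F :: "'a::finite_field poly"
  assumes q: "q = CHAR('a) ^ h"
  shows "pcompose (map_poly (\<lambda>x. x ^ q) g) (F ^ q) = pcompose g F ^ q"
proof (induction g)
  case (pCons a g)
  have "q > 0" by (simp add: q)
  hence "pcompose (map_poly (\<lambda>x. x ^ q) (pCons a g)) (F ^ q)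
      = [:a:] ^ q + (F * pcompose g F) ^ q"
    by (simp add: map_poly_pCons pcompose_pCons pCons.IH power_mult_distrib poly_const_pow)
  also have "\<dots> = ([:a:] + F * pcompose g F) ^ q"
    by (rule freshmans_dream'[symmetric]) (simp_all add: q)
  finally show ?case by (simp add: pcompose_pCons)
qed (simp add: q)

text \<open>Both sides become \<open>(a b)\<^sup>q\<close> after composition with \<open>x\<^sup>q\<close>, and composition with a
  nonconstant polynomial is injective.\<close>

lemma map_poly_frobenius_mult:
  fixes a b :: "'a::finite_field poly"
  assumes q: "q = CHAR('a) ^ h"
  shows "map_poly (\<lambda>x. x ^ q) (a * b) = map_poly (\<lambda>x. x ^ q) a * map_poly (\<lambda>x. x ^ q) b"
proof -
  let ?X = "[:0, 1:] ^ q :: 'a poly" and ?m = "map_poly (\<lambda>x::'a. x ^ q)"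
  have "pcompose (?m (a * b) - ?m a * ?m b) ?X = 0"
    by (simp add: pcompose_diff pcompose_mult pcompose_frobenius[OF q] power_mult_distrib)
  moreover have "degree ?X > 0" by (simp add: degree_power_eq q)
  ultimately show ?thesis using pcompose_eq_0 by fastforce
qed

text \<open>The roots of \<open>g1\<close> are the \<open>q\<close>-th roots of the roots of \<open>g\<close>.  The coefficients of \<open>g1\<close>
  are the \<open>q\<close>-th roots of those of \<open>g\<close>; they exist because Frobenius is bijective on a finite
  field.\<close>

lemma squarefree_pcompose_power_char:
  fixes g :: "'a::finite_field poly"
  assumes "squarefree g" and q: "q = CHAR('a) ^ h"
  shows "\<exists>g1. degree g1 = degree g \<and> squarefree g1 \<and>
           (\<forall>F. pcompose g (F ^ q) = pcompose g1 F ^ q)"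
proof -
  let ?m = "map_poly (\<lambda>x::'a. x ^ q)"
  have q0: "q > 0" by (simp add: q)
  have "inj (\<lambda>x::'a. x ^ q)"
    using frobenius_inj[where n = h and 'b = 'a] by (auto intro!: injI simp: q)
  hence "surj (\<lambda>x::'a. x ^ q)" by (simp add: finite_UNIV_inj_surj)
  then obtain s :: "'a \<Rightarrow> 'a" where s: "\<And>c. s c ^ q = c" by (metis surjD)
  have s0: "s 0 = 0" using s[of 0] q0 by simp
  define g1 where "g1 = map_poly s g"
  have m: "?m g1 = g"
    using q0 by (intro poly_eqI) (simp add: g1_def coeff_map_poly s0 s)
  have deg: "degree (?m x) = degree x" for x
    by (rule degree_map_poly) simp
  have "squarefree g1"
  proof (rule squarefreeI)
    fix x assume "x ^ 2 dvd g1"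
    then obtain y where "g1 = x * x * y" by (auto simp: power2_eq_square)
    hence g: "g = ?m x ^ 2 * ?m y"
      by (simp add: m[symmetric] map_poly_frobenius_mult[OF q] power2_eq_square)
    hence "is_unit (?m x)" using assms(1) by (auto intro: squarefreeD)
    moreover have "x \<noteq> 0" using g assms(1) by auto
    ultimately show "is_unit x" using deg[of x] by (metis is_unit_iff_degree not_is_unit_0)
  qed
  moreover have "degree g1 = degree g" using deg[of g1] by (simp add: m)
  moreover have "pcompose g (F ^ q) = pcompose g1 F ^ q" for F
    using pcompose_frobenius[OF q, of g1 F] by (simp add: m)
  ultimately show ?thesis by blast
qed

section \<open>Growth of the squarefree part along the iteration\<close>

text \<open>The iterates are defined by composing with \<open>f\<close> on the outside; backward orbits are followed
  by composing on the inside.\<close>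

lemma poly_iter_Suc: "poly_iter f (Suc n) = pcompose (poly_iter f n) f"
proof (induction n)
  case (Suc n)
  have "poly_iter f (Suc (Suc n)) = pcompose f (poly_iter f (Suc n))"
    by (simp add: poly_iter_def)
  also have "\<dots> = pcompose (pcompose f (poly_iter f n)) f"
    by (simp add: Suc.IH pcompose_assoc)
  finally show ?case by (simp add: poly_iter_def)
qed (simp add: poly_iter_def pcompose_pCons)

lemma degree_poly_iter:
  fixes f :: "'a::field poly"
  shows "degree (poly_iter f n) = degree f ^ n"
  by (induction n) (simp_all add: poly_iter_def degree_pcompose)

lemma squarefree_part_pcompose:
  fixes a f :: "'a::finite_field poly"
  assumes "a \<noteq> 0"
  shows "squarefree_part (pcompose a f) = squarefree_part (pcompose (squarefree_part a) f)"
  by (simp add: squarefree_part_def[of "pcompose _ _"] irr_factors_pcompose assms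
      squarefree_part_nonzero irr_factors_squarefree_part)

text \<open>One step of the backward orbit: with \<open>S\<close> the squarefree part of \<open>a\<close> and \<open>S1\<close> its inverse
  Frobenius twist, \<open>a \<circ> f\<close> has the same irreducible factors as \<open>S \<circ> f = (S1 \<circ> F)\<^sup>q\<close>, hence as
  \<open>S1 \<circ> F\<close>.\<close>

lemma degree_squarefree_part_pcompose_bounds:
  fixes a f F :: "'a::finite_field poly"
  assumes "a \<noteq> 0" and F: "f = F ^ q" "q = CHAR('a) ^ h" "pderiv F \<noteq> 0"
  shows "degree F * degree (squarefree_part a)
           \<le> degree (squarefree_part (pcompose a f)) + (degree F - 1)"
    and "degree (squarefree_part (pcompose a f)) \<le> degree F * degree (squarefree_part a)"
proof -
  define S where "S = squarefree_part a"
  have S: "squarefree S" unfolding S_def by (rule squarefree_squarefree_part) fact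
  obtain S1 where S1: "degree S1 = degree S" "squarefree S1"
      "\<And>F. pcompose S (F ^ q) = pcompose S1 F ^ q"
    using squarefree_pcompose_power_char[OF S F(2)] by blast
  have q0: "q > 0" by (simp add: F(2))
  have "squarefree_part (pcompose a f) = squarefree_part (pcompose S1 F ^ q)"
    using squarefree_part_pcompose[OF assms(1), of f] by (simp add: S_def[symmetric] S1(3) F(1))
  also have "\<dots> = squarefree_part (pcompose S1 F)"
    unfolding squarefree_part_def by (simp add: irr_factors_power q0)
  finally have eq: "squarefree_part (pcompose a f) = squarefree_part (pcompose S1 F)" .
  show "degree F * degree (squarefree_part a)
      \<le> degree (squarefree_part (pcompose a f)) + (degree F - 1)"
    using degree_pcompose_le_squarefree_part[OF S1(2) F(3)]
    by (simp add: eq S1(1) S_def mult.commute)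
  have "S1 \<noteq> 0" using S1(2) by auto
  hence nz: "pcompose S1 F \<noteq> 0"
    using degree_pderiv_less[OF F(3)] by (simp add: pcompose_eq_0_iff)
  have "degree (squarefree_part (pcompose S1 F)) \<le> degree (pcompose S1 F)"
    by (rule dvd_imp_degree_le[OF squarefree_part_dvd[OF nz] nz])
  thus "degree (squarefree_part (pcompose a f)) \<le> degree F * degree (squarefree_part a)"
    by (simp add: eq degree_pcompose S1(1) S_def mult.commute)
qed

lemma irr_factors_singleton:
  fixes g :: "'a::field poly"
  assumes "g \<noteq> 0" "irr_factors g = {P}"
  shows "\<exists>c k. c \<noteq> 0 \<and> g = smult c (P ^ k)"
proof -
  have P: "P \<in> irr_factors g" using assms(2) by simp
  obtain k K where K: "g = P ^ k * K" "\<not> P dvd K"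
    using prime_power_split[OF irr_factorsD(6)[OF P] assms(1)] by blast
  have "irr_factors K \<subseteq> {P}" unfolding assms(2)[symmetric] by (auto simp: K(1) irr_factors_mult)
  moreover have "P \<notin> irr_factors K" using K(2) by (auto simp: irr_factors_def)
  ultimately have "degree K = 0" using irr_factor_exists[of K] by auto
  then obtain c where "K = [:c:]" using degree_eq_zeroE by blast
  with K assms(1) show ?thesis by (intro exI[of _ c] exI[of _ k]) auto
qed

lemma irr_factors_eq_if_squarefree_part_linear:
  fixes g :: "'a::finite_field poly"
  assumes "degree g > 0" "degree (squarefree_part g) \<le> 1"
  shows "\<exists>\<alpha>. irr_factors g = {[:-\<alpha>, 1:]}"
proof -
  obtain P where P: "P \<in> irr_factors g" using irr_factor_exists[OF assms(1)] by blast
  have g0: "g \<noteq> 0" using assms(1) by auto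
  have fin: "finite (irr_factors g)" by (rule finite_irr_factors[OF g0])
  have sum: "degree (squarefree_part g) = degree P + (\<Sum>Q\<in>irr_factors g - {P}. degree Q)"
    unfolding degree_squarefree_part by (rule sum.remove[OF fin P])
  hence degP: "degree P = 1" and "(\<Sum>Q\<in>irr_factors g - {P}. degree Q) = 0"
    using assms(2) irr_factorsD(6)[OF P] by linarith+
  hence "\<forall>Q\<in>irr_factors g - {P}. degree Q = 0" using fin by simp
  hence "Q \<notin> irr_factors g - {P}" for Q using irr_factorsD(6)[of Q g] by (metis Diff_iff less_irrefl)
  hence "irr_factors g = {P}" using P by blast
  moreover obtain a b where "P = [:a, b:]" using degree1_coeffs[OF degP] by blast
  hence "P = [:- (- a), 1:]" using irr_factorsD(3)[OF P] degP by auto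
  ultimately show ?thesis by blast
qed

text \<open>If \<open>f \<circ> f\<close> had only one root, then the ramification bound would leave \<open>f\<close> with a single
  root \<open>\<alpha>\<close>, and \<open>F = c (x - \<alpha>)\<^sup>k\<close>.  Up to a \<open>q\<close>-th power, \<open>(x - \<alpha>) \<circ> f\<close> is \<open>H = u + v F\<close>
  with constants \<open>u\<close> and \<open>v \<noteq> 0\<close>.  The derivative of \<open>H\<close> vanishes only at \<open>\<alpha>\<close>, where \<open>H\<close> takes
  the value \<open>u\<close>.  So \<open>H\<close> is squarefree of degree \<open>d > 1\<close> when \<open>u \<noteq> 0\<close>, while \<open>u = 0\<close> forces
  \<open>\<alpha> = 0\<close> and makes \<open>f\<close> a monomial.\<close>

lemma squarefree_part_second_iterate:
  fixes f F :: "'a::finite_field poly"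
  assumes F: "f = F ^ q" "q = CHAR('a) ^ h" "pderiv F \<noteq> 0" "degree F > 1"
    and not_monom: "\<not> (\<exists>a k. k \<ge> 1 \<and> f = monom a k)"
  shows "degree (squarefree_part (pcompose f f)) \<ge> 2"
proof (rule ccontr)
  let ?d = "degree F"
  assume "\<not> ?thesis"
  hence le1: "degree (squarefree_part (pcompose f f)) \<le> 1" by simp
  have q0: "q > 0" by (simp add: F(2))
  have degf: "degree f > 0" using F(4) q0 by (cases "F = 0") (auto simp: F(1) degree_power_eq)
  hence f0: "f \<noteq> 0" by auto
  have "?d * degree (squarefree_part f) \<le> 1 + (?d - 1)"
    using degree_squarefree_part_pcompose_bounds(1)[OF f0 F(1-3)] le1 by linarith
  hence "?d * degree (squarefree_part f) \<le> ?d * 1" using F(4) by simp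
  hence "degree (squarefree_part f) \<le> 1" using F(4) by (metis mult_le_cancel1 not_one_less_zero not_gr_zero)
  then obtain \<alpha> where \<alpha>: "irr_factors f = {[:-\<alpha>, 1:]}"
    using irr_factors_eq_if_squarefree_part_linear[OF degf] by blast
  define P where "P = [:-\<alpha>, 1:]"
  have irrF: "irr_factors F = {P}" using \<alpha> by (simp add: P_def F(1) irr_factors_power q0)
  have F0: "F \<noteq> 0" using F(4) by auto
  obtain c k where c: "c \<noteq> 0" and FP: "F = smult c (P ^ k)"
    using irr_factors_singleton[OF F0 irrF] by blast
  have k: "k > 1" using F(4) c by (simp add: FP degree_power_eq P_def)
  have P: "P \<in> irr_factors F" using irrF by simp
  have rad: "squarefree_part f = P" using \<alpha> by (simp add: squarefree_part_def P_def)
  hence sP: "squarefree P" using squarefree_squarefree_part[OF f0] by simp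
  obtain P1 where P1: "degree P1 = degree P" "squarefree P1"
      "\<And>F. pcompose P (F ^ q) = pcompose P1 F ^ q"
    using squarefree_pcompose_power_char[OF sP F(2)] by blast
  have "degree P1 = 1" using P1(1) by (simp add: P_def)
  then obtain u v where uv: "P1 = [:u, v:]" "v \<noteq> 0"
    using degree1_coeffs by (metis)
  define H where "H = pcompose P1 F"
  have H: "H = [:u:] + smult v F" by (simp add: H_def uv pcompose_pCons)
  have degH: "degree H = ?d" by (simp add: H_def degree_pcompose P1(1) P_def)
  have "squarefree_part (pcompose f f) = squarefree_part (H ^ q)"
    using squarefree_part_pcompose[OF f0, of f] by (simp add: rad H_def P1(3)[of F, folded F(1)])
  also have "\<dots> = squarefree_part H" unfolding squarefree_part_def by (simp add: irr_factors_power q0)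
  finally have sH: "degree (squarefree_part H) \<le> 1" using le1 by simp
  show False
  proof (cases "u = 0")
    case False
    \<comment> \<open>The constant 1 is a valid bound on the repeated part, since no factor of \<open>H\<close> repeats.\<close>
    have H0: "H \<noteq> 0" using degH F(4) by auto
    have "degree H \<le> degree (squarefree_part H) + degree (1 :: 'a poly)"
    proof (rule degree_le_squarefree_part_plus[OF H0])
      fix Q l assume Q: "Q \<in> irr_factors H" and l: "Q ^ Suc l dvd H"
      have "l = 0"
      proof (rule ccontr)
        assume "l \<noteq> 0"
        hence "Q dvd Q ^ l" by (simp add: dvd_power)
        also have "\<dots> dvd pderiv H" by (rule power_Suc_dvd_imp_power_dvd_pderiv) (rule l)
        also have "pderiv H = smult v (pderiv F)" by (simp add: H pderiv_add pderiv_smult)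
        also have "\<dots> = P ^ (k - 1) * smult (v * (of_nat k * c)) (pderiv P)"
          by (simp add: FP pderiv_smult pderiv_power ac_simps)
        also have "pderiv P = 1" by (simp add: P_def pderiv_pCons one_pCons)
        finally have "Q dvd P ^ (k - 1) * [:v * (of_nat k * c):]" by simp
        moreover have "v * (of_nat k * c) \<noteq> 0"
        proof
          assume "v * (of_nat k * c) = 0"
          hence "(of_nat k :: 'a) = 0" using uv(2) c by simp
          hence "pderiv F = 0" by (simp add: FP pderiv_smult pderiv_power)
          thus False using F(3) by simp
        qed
        hence "is_unit [:v * (of_nat k * c):]" by (simp add: is_unit_pCons_iff)
        ultimately have "Q dvd P ^ (k - 1)" by (simp only: dvd_mult_unit_iff)
        hence "Q dvd P" using irr_factorsD(1)[OF Q] prime_elem_dvd_power by blast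
        hence "Q dvd F" using irr_factorsD(4)[OF P] dvd_trans by blast
        hence "Q dvd smult v F" by (rule dvd_smult)
        hence "Q dvd [:u:]" using irr_factorsD(4)[OF Q] by (metis H dvd_add_left_iff)
        hence "is_unit Q" using False by (meson dvd_trans is_unit_pCons_iff)
        thus False using irr_factorsD(2)[OF Q] by (simp add: irreducible_not_unit)
      qed
      thus "Q ^ l dvd 1" by simp
    qed simp
    thus False using sH degH F(4) by simp
  next
    case True
    have "pcompose P f = H ^ q" by (simp add: H_def F(1) P1(3))
    also have "\<dots> = smult (v ^ q) f" by (simp add: H True F(1) smult_power)
    finally have eq: "f + [:-\<alpha>:] = smult (v ^ q) f" by (simp add: P_def pcompose_pCons add.commute)
    \<comment> \<open>Comparing leading coefficients gives \<open>v\<^sup>q = 1\<close>, and then \<open>f - \<alpha> = f\<close>.\<close>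
    have "coeff (f + [:-\<alpha>:]) (degree f) = lead_coeff f"
      using degf by (cases "degree f") simp_all
    hence "v ^ q = 1" using f0 by (simp add: eq)
    hence "\<alpha> = 0" using eq by simp
    hence "F = monom c k" by (simp add: FP P_def monom_altdef)
    hence "f = monom (c ^ q) (k * q)" by (simp add: F(1) monom_power)
    moreover have "k * q \<ge> 1" using k q0 by (simp add: Suc_le_eq)
    ultimately show False using not_monom by blast
  qed
qed

text \<open>The lower step only says \<open>\<Delta>\<^sub>n\<^sub>+\<^sub>1 - 1 \<ge> d (\<Delta>\<^sub>n - 1)\<close>, which is empty while \<open>\<Delta>\<^sub>n = 1\<close>.
  The induction therefore starts at the second iterate, and the factor \<open>d\<^sup>2\<close> pays for the two
  lost steps.\<close>

lemma Delta_iter_bounds: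
  fixes f F :: "'a::finite_field poly"
  assumes F: "f = F ^ q" "q = CHAR('a) ^ h" "pderiv F \<noteq> 0" "degree F > 1"
    and not_monom: "\<not> (\<exists>a k. k \<ge> 1 \<and> f = monom a k)"
  shows "Delta_iter f n \<le> degree F ^ n" and "degree F ^ n \<le> (degree F)\<^sup>2 * Delta_iter f n"
proof -
  let ?d = "degree F"
  have f: "f \<noteq> 0" "degree f > 0"
    using F(4) by (cases "F = 0"; simp add: F(1,2) degree_power_eq)+
  have iter0: "poly_iter f m \<noteq> 0" for m
    using degree_poly_iter[of f m] f(2) by (cases m) (auto simp: poly_iter_def)
  note step = degree_squarefree_part_pcompose_bounds[OF iter0 F(1-3), folded poly_iter_Suc]
  have X: "irr_factors [:0, 1 :: 'a:] = {[:0, 1:]}"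
    by (rule irr_factors_irreducible) (simp_all add: irreducible_linear_field_poly)
  hence D0: "Delta_iter f 0 = 1"
    by (simp add: Delta_iter_def squarefree_part_def poly_iter_def)
  show "Delta_iter f n \<le> ?d ^ n"
  proof (induction n)
    case (Suc n)
    have "Delta_iter f (Suc n) \<le> ?d * Delta_iter f n"
      unfolding Delta_iter_def by (rule step(2))
    also have "\<dots> \<le> ?d * ?d ^ n" by (rule mult_left_mono[OF Suc.IH]) simp
    finally show ?case by simp
  qed (simp add: D0)
  have large: "?d ^ m + 1 \<le> Delta_iter f (Suc (Suc m))" for m
  proof (induction m)
    case 0
    have "poly_iter f (Suc (Suc 0)) = pcompose f f"
      by (simp add: poly_iter_Suc) (simp add: poly_iter_def pcompose_pCons)
    thus ?case using squarefree_part_second_iterate[OF F not_monom] by (simp add: Delta_iter_def)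
  next
    case (Suc m)
    have "?d * (?d ^ m + 1) \<le> ?d * Delta_iter f (Suc (Suc m))"
      by (rule mult_left_mono[OF Suc.IH]) simp
    also have "\<dots> \<le> Delta_iter f (Suc (Suc (Suc m))) + (?d - 1)"
      unfolding Delta_iter_def by (rule step(1))
    finally show ?case using F(4) by (simp add: algebra_simps)
  qed
  consider "n = 0" | "n = 1" | m where "n = Suc (Suc m)" by (metis One_nat_def not0_implies_Suc)
  thus "?d ^ n \<le> ?d\<^sup>2 * Delta_iter f n"
  proof cases
    case 1
    thus ?thesis using F(4) by (simp add: D0)
  next
    case 2
    obtain P where P: "P \<in> irr_factors (poly_iter f 1)"
      using irr_factor_exists[of "poly_iter f 1"] degree_poly_iter[of f 1] f(2) by auto
    have "degree P \<le> Delta_iter f 1"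
      unfolding Delta_iter_def degree_squarefree_part
      by (rule member_le_sum[OF P]) (simp_all add: finite_irr_factors[OF iter0])
    hence "Delta_iter f 1 \<ge> 1" using irr_factorsD(6)[OF P] by linarith
    hence "?d * 1 \<le> ?d * (?d * Delta_iter f 1)" using F(4) by (intro mult_left_mono) auto
    thus ?thesis by (simp add: 2 power2_eq_square)
  next
    case 3
    have "?d ^ n = ?d\<^sup>2 * ?d ^ m" by (simp add: 3 power2_eq_square)
    also have "\<dots> \<le> ?d\<^sup>2 * Delta_iter f n"
      using large[of m] by (intro mult_left_mono) (simp_all add: 3)
    finally show ?thesis .
  qed
qed

section \<open>Number and degrees of the irreducible factors\<close>

lemma polys_of_bounded_degree:
  shows "finite {P :: 'a::finite_field poly. degree P \<le> m}"
    and "card {P :: 'a::finite_field poly. degree P \<le> m} \<le> card (UNIV :: 'a set) ^ Suc m"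
proof -
  let ?L = "{xs :: 'a list. set xs \<subseteq> UNIV \<and> length xs = Suc m}"
  have fin: "finite ?L" by (rule finite_lists_length_eq) simp
  have sub: "{P :: 'a poly. degree P \<le> m} \<subseteq> Poly ` ?L"
  proof
    fix P :: "'a poly" assume P: "P \<in> {P. degree P \<le> m}"
    have "P = Poly (map (coeff P) [0..<Suc m])"
    proof (rule poly_eqI)
      fix i show "coeff P i = coeff (Poly (map (coeff P) [0..<Suc m])) i"
        using P by (cases "i < Suc m")
          (auto simp: nth_default_def coeff_eq_0 simp del: upt_Suc)
    qed
    thus "P \<in> Poly ` ?L" by (rule image_eqI) (simp del: upt_Suc)
  qed
  from sub show "finite {P :: 'a poly. degree P \<le> m}"
    using fin by (meson finite_imageI finite_subset)
  have "card {P :: 'a poly. degree P \<le> m} \<le> card (Poly ` ?L)"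
    using fin sub by (intro card_mono finite_imageI)
  also have "\<dots> \<le> card ?L" by (rule card_image_le[OF fin])
  also have "\<dots> = card (UNIV :: 'a set) ^ Suc m" by (rule card_lists_length_eq) simp
  finally show "card {P :: 'a poly. degree P \<le> m} \<le> card (UNIV :: 'a set) ^ Suc m" .
qed

lemma Delta_iter_le:
  fixes f :: "'a::finite_field poly"
  assumes "poly_iter f n \<noteq> 0"
  shows "Delta_iter f n \<le> r_iter f n * D_iter f n"
  unfolding Delta_iter_def degree_squarefree_part r_iter_def D_iter_def
  using finite_irr_factors[OF assms]
  by (metis (no_types, lifting) Max_ge finite_imageI image_eqI sum_bounded_above of_nat_id)

lemma r_iter_le:
  fixes f :: "'a::finite_field poly"
  assumes "poly_iter f n \<noteq> 0"
  shows "r_iter f n \<le> card (UNIV :: 'a set) ^ Suc (D_iter f n)"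
proof -
  have "irr_factors (poly_iter f n) \<subseteq> {P. degree P \<le> D_iter f n}"
    unfolding D_iter_def using finite_irr_factors[OF assms] by auto
  hence "r_iter f n \<le> card {P :: 'a poly. degree P \<le> D_iter f n}"
    unfolding r_iter_def by (intro card_mono polys_of_bounded_degree(1))
  thus ?thesis using polys_of_bounded_degree(2) order_trans by blast
qed

theorem corollary2p5:
  fixes f :: "'a::finite_field poly" and p d :: nat
  assumes "p = CHAR('a)"
    and "degree f > 1"
    and "\<not> (\<exists>a k. k \<ge> 1 \<and> f = monom a k)"
    and "\<not> (\<exists>a b h. f = monom a (p ^ h) + [:b:])"
    and "d = degree (p_reduction f)"
  shows "(\<lambda>n. real (Delta_iter f n)) \<approx> (\<lambda>n. real d ^ n) \<and>
    (\<lambda>n. real (D_iter f n)) \<ggreater> (\<lambda>n. real n) \<and>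
    (\<exists>C>0. \<forall>n. real (r_iter f n) \<ge> C * real d powr (real n / 2)
                \<or> real (D_iter f n) \<ge> C * real d powr (real n / 2))"
proof -
  have degf: "degree f > 0" using assms(2) by simp
  define F where "F = p_reduction f"
  obtain h where h: "f = F ^ (CHAR('a) ^ h)" and F': "pderiv F \<noteq> 0"
    using is_p_reduction_p_reduction[OF degf] by (auto simp: is_p_reduction_def F_def)
  have d1: "degree F > 1"
    unfolding F_def using degf assms(4) by (intro degree_p_reduction_gt_1) (simp_all add: assms(1))
  have dF: "d = degree F" by (simp add: assms(5) F_def)
  note bounds = Delta_iter_bounds[OF h refl F' d1 assms(3), folded dF]
  have d: "d > 1" using d1 by (simp add: dF)
  have iter0: "poly_iter f n \<noteq> 0" for n
    using degree_poly_iter[of f n] degf by (cases n) (auto simp: poly_iter_def)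
  have rD: "d ^ n \<le> d\<^sup>2 * (r_iter f n * D_iter f n)" for n
    using bounds(2)[of n] Delta_iter_le[OF iter0, of n] by (meson mult_le_mono2 order_trans)

  have "real (Delta_iter f n) \<le> real d ^ n" for n
    using bounds(1)[of n] by (metis of_nat_le_iff of_nat_power)
  moreover have "1 / (real d)\<^sup>2 * real d ^ n \<le> real (Delta_iter f n)" for n
  proof -
    have "real (d ^ n) \<le> real (d\<^sup>2 * Delta_iter f n)" using bounds(2) of_nat_le_iff by blast
    thus ?thesis using d by (simp add: field_simps)
  qed
  ultimately have i: "(\<lambda>n. real (Delta_iter f n)) \<approx> (\<lambda>n. real d ^ n)"
    unfolding same_order_def dominates_def using d
    by (intro conjI exI[of _ "1 / (real d)\<^sup>2"] exI[of _ "1 :: real"]) auto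

  have "n \<le> (d\<^sup>2 + 3 * card (UNIV :: 'a set)) * D_iter f n" for n
  proof -
    let ?q = "card (UNIV :: 'a set)" and ?m = "D_iter f n"
    have q2: "?q \<ge> 2"
      using card_mono[of "UNIV :: 'a set" "{0, 1}"] by simp
    \<comment> \<open>Needed to absorb the additive constants of the exponent into a multiple of \<open>D\<^sub>n\<close>.\<close>
    have m1: "?m \<ge> 1"
      using rD[of n] d by (cases "?m = 0") auto
    have "2 ^ n \<le> d ^ n" using d by (intro power_mono) auto
    also have "\<dots> \<le> d\<^sup>2 * (r_iter f n * ?m)" by (rule rD)
    \<comment> \<open>Crude bounds by powers of 2, which leave an inequality linear in \<open>D\<^sub>n\<close> between exponents.\<close>
    also have "\<dots> \<le> 2 ^ (d\<^sup>2) * ((2 ^ ?q) ^ Suc ?m * (2 ^ ?q) ^ ?m)"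
    proof (intro mult_le_mono)
      show "d\<^sup>2 \<le> 2 ^ (d\<^sup>2)" using less_exp[of "d\<^sup>2"] by simp
      have "?q ^ Suc ?m \<le> (2 ^ ?q) ^ Suc ?m" using less_exp[of ?q] by (intro power_mono) auto
      thus "r_iter f n \<le> (2 ^ ?q) ^ Suc ?m" using r_iter_le[OF iter0, of n] by linarith
      have "2 \<le> (2::nat) ^ ?q" using less_exp[of ?q] q2 by linarith
      hence "2 ^ ?m \<le> (2 ^ ?q :: nat) ^ ?m" by (intro power_mono) auto
      thus "?m \<le> (2 ^ ?q) ^ ?m" using less_exp[of ?m] by linarith
    qed
    also have "\<dots> = 2 ^ (d\<^sup>2 + ?q * Suc ?m + ?q * ?m)" by (simp add: power_add power_mult)
    finally have "n \<le> d\<^sup>2 + ?q * Suc ?m + ?q * ?m" by (simp add: power_increasing_iff)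
    also have "\<dots> \<le> d\<^sup>2 * ?m + ?q * (?m + ?m) + ?q * ?m"
      using m1 by (intro add_mono mult_left_mono) auto
    also have "\<dots> = (d\<^sup>2 + 3 * ?q) * ?m" by (simp add: algebra_simps)
    finally show ?thesis .
  qed
  hence "real n \<le> real (d\<^sup>2 + 3 * card (UNIV :: 'a set)) * real (D_iter f n)" for n
    by (metis of_nat_le_iff of_nat_mult)
  hence ii: "(\<lambda>n. real (D_iter f n)) \<ggreater> (\<lambda>n. real n)"
    unfolding dominates_def using d
    by (intro exI[of _ "1 / real (d\<^sup>2 + 3 * card (UNIV :: 'a set))"])
       (auto simp: pos_divide_le_eq add_pos_nonneg mult.commute simp del: of_nat_add)

  have iii: "real (r_iter f n) \<ge> 1 / real d * real d powr (real n / 2)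
           \<or> real (D_iter f n) \<ge> 1 / real d * real d powr (real n / 2)" for n
  proof (rule ccontr)
    let ?t = "1 / real d * real d powr (real n / 2)"
    assume "\<not> ?thesis"
    hence "real (r_iter f n) * real (D_iter f n) < ?t * ?t"
      by (intro mult_strict_mono') auto
    also have "\<dots> = real d powr (real n / 2 + real n / 2) / (real d)\<^sup>2"
      by (simp add: power2_eq_square flip: powr_add)
    also have "\<dots> = real d ^ n / (real d)\<^sup>2" using d by (simp add: powr_realpow)
    finally have "(real d)\<^sup>2 * (real (r_iter f n) * real (D_iter f n)) < real d ^ n"
      using d by (simp add: field_simps)
    moreover have "real (d ^ n) \<le> real (d\<^sup>2 * (r_iter f n * D_iter f n))"
      using rD of_nat_le_iff by blast
    ultimately show False by simp
  qed
  show ?thesis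
    using i ii iii d by (intro conjI exI[of _ "1 / real d"]) auto
qed

end
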